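(* Fix $n\ge 1$ and $j\in[n]$. (1) If $w\sim \mathrm{Unif}(S_n)$, then $\Pr[\mathrm{rec}_j(w)=1]=\frac1j$. (2) If $w\sim \mathrm{Unif}(\mathcal G_n)$, then \[\Pr[\mathrm{rec}_j(w)=1]=\frac{\sum_{k=j}^{n}\binom{n}{k}+2^{j-1}-n}{2^n-n}.\] (3) If $w\sim\mathrm{Unif}(\mathcal B_n)$, then \[\Pr[\mathrm{rec}_j(w)=1]=\frac{F_{2n-2}-F_{2j-4}F_{2(n-j)-1}}{F_{2n-1}}=\frac{2\phi^{2n-2}+2\phi^{2-2n}+\phi^{2n-4j+3}-\phi^{4j-2n-3}}{\sqrt5\,(\phi^{2n-1}+\phi^{1-2n})},\] where $\phi=\frac{1+\sqrt5}{2}$.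
   Context: Permutations $w\in S_n$ are written in one-line notation $w(1)\cdots w(n)$. Position $j$ is a record (left-to-right maximum) of $w$ if there is no $k<j$ with $w(k)>w(j)$; $\mathrm{rec}_j(w)$ is the indicator of this event. $\mathrm{Unif}(\mathcal W)$ is the uniform distribution on a finite set $\mathcal W$. $\mathcal G_n$ is the set of Grassmannian permutations in $S_n$, i.e. those with at most one index $m\in\{1,\dots,n-1\}$ with $w(m)>w(m+1)$. $\mathcal B_n$ is the set of Boolean permutations in $S_n$, i.e. those that can be written as a product of simple transpositions $s_i=(i\ i{+}1)$ in which no $s_i$ appears more than once. $F_m$ is the Fibonacci sequence ($F_0=0$, $F_1=F_2=1$, $F_{m+1}=F_m+F_{m-1}$), extended to negative indices by $F_{-m}=(-1)^{m+1}F_m$. *)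

theory Defs
  imports
    "HOL-Probability.Probability"
    "HOL-Combinatorics.Combinatorics"
    "HOL-Number_Theory.Fib"
begin

definition Sym :: "nat \<Rightarrow> (nat \<Rightarrow> nat) set" where
  "Sym n = {w. w permutes {1..n}}"

definition Grassmannian :: "nat \<Rightarrow> (nat \<Rightarrow> nat) set" where
  "Grassmannian n = {w \<in> Sym n. card {m \<in> {1..<n}. w m > w (m + 1)} \<le> 1}"

text \<open>The name \<open>transpose\<close> alone is ambiguous: lists and matrices have one, too.\<close>

definition simple_transposition :: "nat \<Rightarrow> nat \<Rightarrow> nat" where
  "simple_transposition i = Transposition.transpose i (i + 1)"

definition word_product :: "nat list \<Rightarrow> nat \<Rightarrow> nat" where
  "word_product is = foldr (\<circ>) (map simple_transposition is) id"

definition Boolean :: "nat \<Rightarrow> (nat \<Rightarrow> nat) set" where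
  "Boolean n = {w \<in> Sym n. \<exists>is. set is \<subseteq> {1..<n} \<and> distinct is \<and> w = word_product is}"

text \<open>Positions start at 1, so position 0, which elements of \<open>Sym n\<close> fix, is left out.\<close>

definition rec_indicator :: "nat \<Rightarrow> (nat \<Rightarrow> nat) \<Rightarrow> nat" where
  "rec_indicator j w = of_bool (\<not> (\<exists>k\<in>{1..<j}. w k > w j))"

definition fib_int :: "int \<Rightarrow> int" where
  "fib_int m = (if m \<ge> 0 then int (fib (nat m))
                else (- 1) ^ (nat (- m) + 1) * int (fib (nat (- m))))"

definition golden_ratio :: real where
  "golden_ratio = (1 + sqrt 5) / 2"

text \<open>On an infinite or empty set \<open>pmf_of_set\<close> would be unspecified.\<close>

lemma finite_Sym: "finite (Sym n)"
  unfolding Sym_def by (rule finite_permutations) simp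

lemma finite_Grassmannian: "finite (Grassmannian n)"
  using finite_Sym by (rule finite_subset[rotated]) (auto simp: Grassmannian_def)

lemma finite_Boolean: "finite (Boolean n)"
  using finite_Sym by (rule finite_subset[rotated]) (auto simp: Boolean_def)

lemma id_in_Sym: "id \<in> Sym n"
  by (simp add: Sym_def permutes_id)

lemma id_in_Grassmannian: "id \<in> Grassmannian n"
  by (simp add: Grassmannian_def id_in_Sym)

lemma id_in_Boolean: "id \<in> Boolean n"
  by (auto simp: Boolean_def id_in_Sym word_product_def intro!: exI[of _ "[]"])

end

(* Uniform case: the position of the maximum of w(1), ..., w(j) is equidistributed over {1..j}.
   Grassmannian case: pairs (w, m) with w increasing on {1..m} and on {m+1..n} correspond to the
   subsets w{1..m} of {1..n}, and the identity occurs in n + 1 pairs, every other Grassmannian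
   permutation in one.  Position j is a record of w exactly if the subset has at least j elements
   or is contained in {1..j-1}.
   Boolean case: with s the last generator, B(n+1) is the disjoint union of B(n) and
   B(n) s \<union> s B(n), where B(n) s \<inter> s B(n) = B(n-1) s; multiplication by s hardly changes
   records, so the counts satisfy a(n+1) = 3 a(n) - a(n-1), the recurrence of every other
   Fibonacci number. *)
theory Submission
  imports Defs
begin

section \<open>Records as events, and the uniform distribution on all permutations\<close>

definition records :: "nat \<Rightarrow> (nat \<Rightarrow> nat) set" where
  "records j = {w. rec_indicator j w = 1}"

lemma mem_records_iff: "w \<in> records j \<longleftrightarrow> (\<forall>k\<in>{1..<j}. w k \<le> w j)"
  by (auto simp: records_def rec_indicator_def not_less)

lemma prob_records:
  assumes "finite W" and "W \<noteq> {}"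
  shows "measure_pmf.prob (pmf_of_set W) {w. rec_indicator j w = 1} = card (W \<inter> records j) / card W"
  using assms by (simp add: records_def measure_pmf_of_set)

lemma Sym_inj: "w \<in> Sym n \<Longrightarrow> inj w"
  by (simp add: Sym_def permutes_inj)

lemma Sym_in_iff: "w \<in> Sym n \<Longrightarrow> w x \<in> {1..n} \<longleftrightarrow> x \<in> {1..n}"
  unfolding Sym_def using permutes_in_image by fastforce

lemma Sym_fixed: "w \<in> Sym n \<Longrightarrow> x \<notin> {1..n} \<Longrightarrow> w x = x"
  unfolding Sym_def using permutes_not_in by fastforce

lemma Sym_image: "w \<in> Sym n \<Longrightarrow> w ` {1..n} = {1..n}"
  by (simp add: Sym_def permutes_image)

lemma Sym_mono: "m \<le> n \<Longrightarrow> Sym m \<subseteq> Sym n"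
  by (auto simp: Sym_def intro: permutes_subset)

lemma card_Sym: "card (Sym n) = fact n"
  by (simp add: Sym_def card_permutations)

text \<open>The classes \<open>A i\<close> of permutations whose largest value on
  \<open>{1..j}\<close> sits at position i partition \<open>Sym n\<close>. Swapping the positions i
  and j maps \<open>A i\<close> onto \<open>A j\<close>, so the j classes have equal size, and
  \<open>A j\<close> is the event.\<close>

lemma card_Sym_records:
  assumes j: "j \<in> {1..n}"
  shows "j * card (Sym n \<inter> records j) = fact n"
proof -
  define A where "A i = {w \<in> Sym n. \<forall>k\<in>{1..j}. w k \<le> w i}" for i
  have Aj: "A j = Sym n \<inter> records j"
  proof -
    have "{1..j} = insert j {1..<j}" using j by auto
    then show ?thesis by (auto simp: A_def mem_records_iff)
  qed
  have eq: "card (A i) = card (A j)" if i: "i \<in> {1..j}" for i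
  proof (rule bij_betw_same_card)
    let ?t = "Transposition.transpose i j"
    have t: "?t permutes {1..j}" "?t permutes {1..n}"
      using i j by (auto intro: permutes_swap_id)
    \<comment> \<open>Left general in k: k = i and k = j give the two directions of the bijection,
      as the transposition is its own inverse.\<close>
    have mem: "w \<circ> ?t \<in> A (?t k)" if "w \<in> A k" for w k
      unfolding A_def
    proof (intro CollectI conjI ballI)
      show "w \<circ> ?t \<in> Sym n"
        using that t(2) by (auto simp: A_def Sym_def intro: permutes_compose)
      fix l assume "l \<in> {1..j}"
      then have "?t l \<in> {1..j}"
        using t(1) permutes_in_image by metis
      then show "(w \<circ> ?t) l \<le> (w \<circ> ?t) (?t k)"
        using that by (auto simp: A_def)
    qed
    show "bij_betw (\<lambda>w. w \<circ> ?t) (A i) (A j)"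
      by (rule bij_betw_byWitness[where f' = "\<lambda>w. w \<circ> ?t"])
        (use mem[of _ i] mem[of _ j] in \<open>simp_all add: comp_assoc image_subset_iff\<close>)
  qed
  have "Sym n = (\<Union>i\<in>{1..j}. A i)"
  proof (intro equalityI subsetI)
    fix w assume w: "w \<in> Sym n"
    have "Max (w ` {1..j}) \<in> w ` {1..j}"
      using j by (intro Max_in) auto
    then obtain i where i: "i \<in> {1..j}" "w i = Max (w ` {1..j})"
      by fastforce
    then have "w \<in> A i"
      using w by (auto simp: A_def)
    then show "w \<in> (\<Union>i\<in>{1..j}. A i)"
      using i(1) by blast
  qed (auto simp: A_def)
  moreover have "A i \<inter> A k = {}" if "i \<in> {1..j}" "k \<in> {1..j}" "i \<noteq> k" for i k
  proof -
    have False if w: "w \<in> A i" "w \<in> A k" for w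
    proof -
      have "w i \<le> w k" "w k \<le> w i"
        using w \<open>i \<in> {1..j}\<close> \<open>k \<in> {1..j}\<close> by (simp_all add: A_def)
      then have "w i = w k" by simp
      moreover have "inj w" using w Sym_inj[of w n] by (simp add: A_def)
      ultimately show False using \<open>i \<noteq> k\<close> by (simp add: inj_eq)
    qed
    then show ?thesis by blast
  qed
  moreover have "finite (A i)" for i
    using finite_Sym by (auto simp: A_def)
  ultimately have "card (Sym n) = (\<Sum>i\<in>{1..j}. card (A i))"
    using card_UN_disjoint[of "{1..j}" A] by simp
  also have "\<dots> = (\<Sum>i\<in>{1..j}. card (A j))"
    by (rule sum.cong[OF refl]) (rule eq)
  finally have "card (Sym n) = j * card (A j)"
    by simp
  then show ?thesis
    by (simp add: card_Sym Aj)
qed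

section \<open>Grassmannian permutations\<close>

text \<open>A finite set has only one increasing enumeration: listed over \<open>{a..b}\<close>,
  both functions yield strictly sorted lists with the same elements.\<close>

lemma strict_mono_on_unique:
  fixes f g :: "nat \<Rightarrow> 'a::linorder"
  assumes "strict_mono_on {a..b} f" and "strict_mono_on {a..b} g"
    and "f ` {a..b} = g ` {a..b}" and "i \<in> {a..b}"
  shows "f i = g i"
proof -
  have sorted: "sorted_wrt (<) (map h [a..<Suc b])"
    if "strict_mono_on {a..b} h" for h :: "nat \<Rightarrow> 'a"
    unfolding sorted_wrt_map
    by (rule sorted_wrt_mono_rel[OF _ sorted_wrt_upt])
      (use that in \<open>auto simp: strict_mono_on_def\<close>)
  have "map f [a..<Suc b] = map g [a..<Suc b]"
    using assms by (intro strict_sorted_equal sorted) (simp_all add: atLeastLessThanSuc_atLeastAtMost del: upt_Suc)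
  then show ?thesis
    using assms(4) by (auto simp: map_eq_conv simp del: upt_Suc)
qed

lemma strict_mono_on_stepI:
  fixes f :: "nat \<Rightarrow> 'a::order"
  assumes "\<And>i. i \<in> {a..<b} \<Longrightarrow> f i < f (Suc i)"
  shows "strict_mono_on {a..b} f"
proof (rule strict_mono_onI)
  fix r s assume "r \<in> {a..b}" "s \<in> {a..b}" "r < s"
  then have "a \<le> r" "s \<le> b" by simp_all
  with \<open>r < s\<close> show "f r < f s"
  proof (induction r s rule: less_Suc_induct)
    case (1 i)
    then show ?case using assms by simp
  next
    case (2 i j k)
    then show ?case by (meson le_trans less_imp_le less_trans)
  qed
qed

lemma Sym_strict_mono_eq_id:
  assumes "w \<in> Sym n" and "strict_mono_on {1..n} w"
  shows "w = id"
proof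
  fix i show "w i = id i"
  proof (cases "i \<in> {1..n}")
    case True
    then show ?thesis
      using assms Sym_image[OF assms(1)] by (intro strict_mono_on_unique[of 1 n w id i]) (auto intro: strict_mono_onI)
  qed (simp add: Sym_fixed[OF assms(1)])
qed

section \<open>Descents, and cuts into two increasing blocks\<close>

definition descents :: "nat \<Rightarrow> (nat \<Rightarrow> nat) \<Rightarrow> nat set" where
  "descents n w = {m \<in> {1..<n}. w m > w (m + 1)}"

text \<open>Empty blocks are allowed: with m = 0 and m = n included, the pairs of a permutation and
  a cut become equinumerous with all subsets of \<open>{1..n}\<close>.\<close>

definition cuts :: "nat \<Rightarrow> (nat \<Rightarrow> nat) \<Rightarrow> nat set" where
  "cuts n w = {m. m \<le> n \<and> strict_mono_on {1..m} w \<and> strict_mono_on {m+1..n} w}"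

text \<open>The positions i and i + 1 lie in the same block unless i = m, so both blocks are
  increasing exactly if no descent occurs away from m.\<close>

lemma cuts_eq:
  assumes w: "w \<in> Sym n"
  shows "cuts n w = {m. m \<le> n \<and> descents n w \<subseteq> {m}}"
proof (intro equalityI subsetI)
  fix m assume m: "m \<in> cuts n w"
  have "w i < w (i + 1)" if "i \<in> {1..<n}" "i \<noteq> m" for i
    using m that by (cases "i < m") (auto simp: cuts_def strict_mono_on_def)
  then show "m \<in> {m. m \<le> n \<and> descents n w \<subseteq> {m}}"
    using m by (fastforce simp: cuts_def descents_def)
next
  fix m assume m: "m \<in> {m. m \<le> n \<and> descents n w \<subseteq> {m}}"
  have "w i < w (Suc i)" if "i \<in> {1..<n}" "i \<noteq> m" for i
    using m that Sym_inj[OF w, THEN injD, of i "Suc i"]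
    by (force simp: descents_def)
  then show "m \<in> cuts n w"
    using m by (auto simp: cuts_def intro!: strict_mono_on_stepI)
qed

lemma descents_empty_imp_id:
  assumes "w \<in> Sym n" and "descents n w = {}"
  shows "w = id"
proof -
  have "n \<in> cuts n w"
    using assms by (simp add: cuts_eq)
  then show ?thesis
    using assms(1) Sym_strict_mono_eq_id by (simp add: cuts_def)
qed

lemma Grassmannian_iff: "w \<in> Grassmannian n \<longleftrightarrow> w \<in> Sym n \<and> cuts n w \<noteq> {}"
proof (cases "w \<in> Sym n")
  case True
  have fin: "finite (descents n w)"
    by (simp add: descents_def)
  have "card (descents n w) \<le> 1 \<longleftrightarrow> (\<exists>m\<le>n. descents n w \<subseteq> {m})"
  proof
    assume "card (descents n w) \<le> 1"
    then have "card (descents n w) = 0 \<or> card (descents n w) = 1" by linarith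
    then consider "descents n w = {}" | m where "descents n w = {m}"
      using fin by (metis card_0_eq card_1_singletonE)
    then show "\<exists>m\<le>n. descents n w \<subseteq> {m}"
    proof cases
      case 2
      then have "m \<in> descents n w" by simp
      then show ?thesis using 2 by (intro exI[of _ m]) (auto simp: descents_def)
    qed auto
  next
    assume "\<exists>m\<le>n. descents n w \<subseteq> {m}"
    then obtain m where "descents n w \<subseteq> {m}" by blast
    from card_mono[OF _ this] show "card (descents n w) \<le> 1" by simp
  qed
  moreover have "w \<in> Grassmannian n \<longleftrightarrow> card (descents n w) \<le> 1"
    using True by (simp add: Grassmannian_def descents_def)
  ultimately show ?thesis
    using True by (auto simp: cuts_eq)
qed (simp add: Grassmannian_def)

text \<open>A descent has to be the cut, which makes the cut unique. Only the identity has no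
  descent, and then each of 0, ..., n is a cut.\<close>

lemma card_cuts:
  assumes "w \<in> Grassmannian n"
  shows "card (cuts n w) = (if w = id then n + 1 else 1)"
proof -
  have w: "w \<in> Sym n" using assms by (simp add: Grassmannian_iff)
  show ?thesis
  proof (cases "w = id")
    case True
    then have "cuts n w = {..n}"
      using w by (auto simp: cuts_eq descents_def)
    then show ?thesis using True by simp
  next
    case False
    obtain m where m: "m \<in> cuts n w"
      using assms by (auto simp: Grassmannian_iff)
    have "cuts n w = {m}"
      using m descents_empty_imp_id[OF w] False by (auto simp: cuts_eq[OF w])
    then show ?thesis using False by simp
  qed
qed

text \<open>Counting pairs instead of permutations overcounts only the identity, by n. The total is
  the case \<open>Q = UNIV\<close>, the event the case \<open>Q = records j\<close>; the identity
  lies in both.\<close>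

lemma card_Grassmannian_cuts:
  assumes "id \<in> Q"
  shows "card (SIGMA w:Grassmannian n \<inter> Q. cuts n w) = card (Grassmannian n \<inter> Q) + n"
proof -
  have fin: "finite (Grassmannian n \<inter> Q)" using finite_Grassmannian by blast
  have "finite (cuts n w)" for w
    by (rule finite_subset[of _ "{..n}"]) (auto simp: cuts_def)
  then have "card (SIGMA w:Grassmannian n \<inter> Q. cuts n w) = (\<Sum>w\<in>Grassmannian n \<inter> Q. card (cuts n w))"
    using fin by (simp add: card_SigmaI)
  also have "\<dots> = (\<Sum>w\<in>Grassmannian n \<inter> Q. 1 + (if w = id then n else 0))"
    by (intro sum.cong) (auto simp: card_cuts)
  also have "\<dots> = card (Grassmannian n \<inter> Q) + n"
    using fin assms by (subst sum.distrib) (simp add: id_in_Grassmannian)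
  finally show ?thesis .
qed

section \<open>Pairs of a Grassmannian permutation and a cut as subsets\<close>

lemma image_upper_block:
  assumes "w \<in> Sym n" and "m \<le> n"
  shows "w ` {m+1..n} = {1..n} - w ` {1..m}"
proof -
  have "{m+1..n} = {1..n} - {1..m}"
    using assms(2) by auto
  then show ?thesis
    using Sym_inj[OF assms(1)] Sym_image[OF assms(1)] by (simp add: image_set_diff)
qed

lemma Sym_ext:
  assumes "v \<in> Sym n" "w \<in> Sym n" and "\<And>i. i \<in> {1..n} \<Longrightarrow> v i = w i"
  shows "v = w"
proof
  fix i show "v i = w i"
    using assms(3) Sym_fixed[OF assms(1)] Sym_fixed[OF assms(2)] by (cases "i \<in> {1..n}") simp_all
qed

text \<open>The pair can be read off from the set of values in the first block: m is its
  cardinality, and w lists the set and then its complement, each in increasing order.\<close>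

lemma bij_betw_cuts_Pow:
  "bij_betw (\<lambda>(w, m). w ` {1..m}) (SIGMA w:Grassmannian n. cuts n w) (Pow {1..n})"
  unfolding bij_betw_def
proof
  show "inj_on (\<lambda>(w, m). w ` {1..m}) (SIGMA w:Grassmannian n. cuts n w)"
  proof (rule inj_onI, clarsimp)
    fix v l w m
    assume v: "v \<in> Grassmannian n" "l \<in> cuts n v" and w: "w \<in> Grassmannian n" "m \<in> cuts n w"
      and eq: "v ` {Suc 0..l} = w ` {Suc 0..m}"
    have S: "v \<in> Sym n" "w \<in> Sym n"
      using v w by (simp_all add: Grassmannian_iff)
    have "card (v ` {Suc 0..l}) = l" "card (w ` {Suc 0..m}) = m"
      using S[THEN Sym_inj] by (simp_all add: card_image inj_on_subset)
    with eq have lm: "l = m" by simp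
    have "v i = w i" if "i \<in> {1..n}" for i
    proof (cases "i \<le> m")
      case True
      then show ?thesis
        using v(2) w(2) eq that unfolding lm cuts_def
        by (intro strict_mono_on_unique[of 1 m v w]) simp_all
    next
      case False
      moreover have "v ` {m+1..n} = w ` {m+1..n}"
      proof -
        have "m \<le> n" using w(2) by (simp add: cuts_def)
        then show ?thesis
          using eq lm image_upper_block[OF S(1), of m] image_upper_block[OF S(2), of m] by simp
      qed
      ultimately show ?thesis
        using v(2) w(2) that unfolding lm cuts_def
        by (intro strict_mono_on_unique[of "m+1" n v w]) simp_all
    qed
    then show "v = w \<and> l = m"
      using S lm Sym_ext by blast
  qed
  show "(\<lambda>(w, m). w ` {1..m}) ` (SIGMA w:Grassmannian n. cuts n w) = Pow {1..n}"
  proof (intro equalityI subsetI)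
    fix A assume "A \<in> Pow {1..n}"
    then have A: "A \<subseteq> {1..n}" by simp
    define B where "B = {1..n} - A"
    have fin: "finite A" "finite B"
      using A finite_subset by (auto simp: B_def)
    define m where "m = card A"
    have mn: "m \<le> n"
      using card_mono[OF _ A] by (simp add: m_def)
    have cB: "card B = n - m"
      using A fin by (simp add: B_def m_def card_Diff_subset)
    obtain f where f: "bij_betw f {..<m} A" "strict_mono_on {..<m} f"
      using ex_bij_betw_strict_mono_card[OF fin(1)] unfolding m_def by metis
    obtain g where g: "bij_betw g {..<n - m} B" "strict_mono_on {..<n - m} g"
      using ex_bij_betw_strict_mono_card[OF fin(2)] unfolding cB by metis
    \<comment> \<open>The preimage of A. The enumerations \<open>f\<close> and \<open>g\<close>
      start at index 0, which explains the shifts by 1 and by m + 1; outside \<open>{1..n}\<close>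
      an element of \<open>Sym n\<close> has to be the identity.\<close>
    define w where "w i = (if i \<notin> {1..n} then i else if i \<le> m then f (i - 1) else g (i - m - 1))" for i
    have "w ` {1..m} = f ` (\<lambda>i. i - 1) ` {1..m}"
      using mn unfolding image_image by (intro image_cong) (auto simp: w_def)
    also have "(\<lambda>i. i - 1) ` {1..m} = {..<m}"
    proof (intro equalityI subsetI)
      fix x assume "x \<in> {..<m}"
      then show "x \<in> (\<lambda>i. i - 1) ` {1..m}" by (intro image_eqI[of _ _ "Suc x"]) auto
    qed auto
    finally have wA: "w ` {1..m} = A"
      using f by (simp add: bij_betw_def)
    have "w ` {m+1..n} = g ` (\<lambda>i. i - m - 1) ` {m+1..n}"
      using mn unfolding image_image by (intro image_cong) (auto simp: w_def)
    also have "(\<lambda>i. i - m - 1) ` {m+1..n} = {..<n - m}"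
    proof (intro equalityI subsetI)
      fix x assume "x \<in> {..<n - m}"
      then show "x \<in> (\<lambda>i. i - m - 1) ` {m+1..n}" by (intro image_eqI[of _ _ "x + m + 1"]) auto
    qed auto
    finally have wB: "w ` {m+1..n} = B"
      using g by (simp add: bij_betw_def)
    have "{1..n} = {1..m} \<union> {m+1..n}" using mn by auto
    then have wI: "w ` {1..n} = {1..n}"
      using wA wB A by (simp only: image_Un) (auto simp: B_def)
    then have "inj_on w {1..n}" by (intro finite_surj_inj) auto
    with wI have "bij_betw w {1..n} {1..n}" by (simp add: bij_betw_def)
    then have "w permutes {1..n}"
      by (rule bij_imp_permutes) (simp add: w_def)
    then have wS: "w \<in> Sym n" by (simp add: Sym_def)
    have "strict_mono_on {1..m} w"
    proof (rule strict_mono_onI)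
      fix r s assume "r \<in> {1..m}" "s \<in> {1..m}" "r < s"
      then show "w r < w s"
        using mn strict_mono_onD[OF f(2), of "r - 1" "s - 1"] by (auto simp: w_def)
    qed
    moreover have "strict_mono_on {m+1..n} w"
    proof (rule strict_mono_onI)
      fix r s assume "r \<in> {m+1..n}" "s \<in> {m+1..n}" "r < s"
      then show "w r < w s"
        using mn strict_mono_onD[OF g(2), of "r - m - 1" "s - m - 1"] by (auto simp: w_def)
    qed
    ultimately have "m \<in> cuts n w"
      using mn by (simp add: cuts_def)
    then have "(w, m) \<in> (SIGMA w:Grassmannian n. cuts n w)"
      using wS by (auto simp: Grassmannian_iff)
    then show "A \<in> (\<lambda>(w, m). w ` {1..m}) ` (SIGMA w:Grassmannian n. cuts n w)"
      by (rule rev_image_eqI) (simp add: wA del: One_nat_def)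
  next
    fix A assume "A \<in> (\<lambda>(w, m). w ` {1..m}) ` (SIGMA w:Grassmannian n. cuts n w)"
    then obtain w m where *: "w \<in> Sym n" "m \<le> n" "A = w ` {1..m}"
      by (auto simp: Grassmannian_iff cuts_def)
    have "w ` {1..m} \<subseteq> w ` {1..n}" using * by (intro image_mono) auto
    then show "A \<in> Pow {1..n}"
      using * Sym_image by simp
  qed
qed

lemma card_Grassmannian: "card (Grassmannian n) + n = 2 ^ n"
proof -
  have "card (SIGMA w:Grassmannian n. cuts n w) = card (Pow {1..n})"
    by (rule bij_betw_same_card[OF bij_betw_cuts_Pow])
  also have "\<dots> = 2 ^ n"
    by (simp add: card_Pow)
  finally have "card (SIGMA w:Grassmannian n. cuts n w) = 2 ^ n" .
  moreover have "card (SIGMA w:Grassmannian n. cuts n w) = card (Grassmannian n) + n"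
    using card_Grassmannian_cuts[OF UNIV_I, of n] unfolding Int_UNIV_right .
  ultimately show ?thesis by metis
qed

text \<open>Inside the first block every position is a record. Beyond it, only values of the first
  block can exceed \<open>w j\<close>, and the condition says that these all lie below j.\<close>

lemma records_cut_iff:
  assumes w: "w \<in> Sym n" and m: "m \<in> cuts n w" and j: "j \<in> {1..n}"
  shows "w \<in> records j \<longleftrightarrow> j \<le> m \<or> w ` {1..m} \<subseteq> {1..<j}"
proof (cases "j \<le> m")
  case True
  then show ?thesis
    using m j unfolding mem_records_iff cuts_def strict_mono_on_def
    by (auto intro!: less_imp_le)
next
  case False
  have up: "w k < w l" if "m < k" "k < l" "l \<le> n" for k l
    using m that by (auto simp: cuts_def strict_mono_on_def)
  have "w ` {1..m} \<subseteq> {1..<j}" if rec: "w \<in> records j"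
  proof -
    have low: "w k < w j" if "k \<in> {1..<j}" for k
    proof -
      have "w k \<le> w j" using rec that by (simp add: mem_records_iff)
      moreover have "w k \<noteq> w j" using Sym_inj[OF w, THEN injD, of k j] that by auto
      ultimately show ?thesis by simp
    qed
    \<comment> \<open>A value below \<open>w j\<close> cannot occur after j, since the second block
      increases from there. So the values before a record at j are all those below
      \<open>w j\<close>.\<close>
    have "w ` {1..<j} = {1..<w j}"
    proof (intro equalityI subsetI)
      fix y assume "y \<in> w ` {1..<j}"
      then show "y \<in> {1..<w j}"
        using low j Sym_in_iff[OF w] by fastforce
    next
      fix y assume y: "y \<in> {1..<w j}"
      moreover have "w j \<in> {1..n}" using Sym_in_iff[OF w] j by blast
      ultimately have "y \<in> w ` {1..n}" using Sym_image[OF w] by simp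
      then obtain k where k: "k \<in> {1..n}" "y = w k" by auto
      then have "k < j"
        using y up[of j k] False by (cases k j rule: linorder_cases) auto
      then show "y \<in> w ` {1..<j}" using k by auto
    qed
    moreover from this have "card {1..<j} = card {1..<w j}"
      using Sym_inj[OF w] card_image[of w "{1..<j}"] by (simp add: inj_on_subset)
    \<comment> \<open>The cardinalities give j - 1 = \<open>w j\<close> - 1 in truncated
      subtraction; \<open>w j\<close> = j follows because both numbers are positive.\<close>
    moreover have "w j \<ge> 1" using Sym_in_iff[OF w, of j] j by simp
    ultimately have "w ` {1..<j} = {1..<j}" using j by auto
    moreover have "{1..m} \<subseteq> {1..<j}" using False by auto
    ultimately show ?thesis by blast
  qed
  moreover have "w \<in> records j" if sub: "w ` {1..m} \<subseteq> {1..<j}"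
  proof -
    have "j \<le> w j"
    proof (rule ccontr)
      assume "\<not> j \<le> w j"
      \<comment> \<open>Pigeonhole: if \<open>w j\<close> were below j, all j values on
        \<open>{1..j}\<close> would lie among j - 1 numbers.\<close>
      have "w ` {1..j} \<subseteq> {1..<j}"
      proof (intro subsetI, elim imageE)
        fix y k assume k: "y = w k" "k \<in> {1..j}"
        show "y \<in> {1..<j}"
        proof (cases "k \<le> m")
          case True
          then have "w k \<in> w ` {1..m}" using k by auto
          then show ?thesis using sub k by blast
        next
          case F: False
          then have "w k \<le> w j"
            using up[of k j] k j by (cases "k = j") auto
          moreover have "w k \<in> {1..n}" using Sym_in_iff[OF w] k j by fastforce
          ultimately show ?thesis using k \<open>\<not> j \<le> w j\<close> by simp
        qed
      qed
      then have "card (w ` {1..j}) \<le> card {1..<j}" by (intro card_mono) auto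
      moreover have "card (w ` {1..j}) = j"
        using Sym_inj[OF w] by (simp add: card_image inj_on_subset)
      ultimately show False using j by auto
    qed
    have "w k \<le> w j" if "k \<in> {1..<j}" for k
    proof (cases "k \<le> m")
      case True
      then have "w k \<in> w ` {1..m}" using that by auto
      then show ?thesis using sub \<open>j \<le> w j\<close> by fastforce
    next
      case False
      then show ?thesis using up[of k j] that j by simp
    qed
    then show ?thesis by (simp add: mem_records_iff)
  qed
  ultimately show ?thesis using False by blast
qed

text \<open>A subset of \<open>{1..<j}\<close> has fewer than j elements, so the two alternatives
  exclude each other; the sum counts the large subsets by their size.\<close>

lemma card_large_or_initial_subsets:
  assumes j: "j \<in> {1..n}"
  shows "card {A \<in> Pow {1..n}. j \<le> card A \<or> A \<subseteq> {1..<j}} = (\<Sum>k=j..n. n choose k) + 2 ^ (j - 1)"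
proof -
  define L where "L k = {A. A \<subseteq> {1..n} \<and> card A = k}" for k
  have fin: "finite (L k)" for k
    unfolding L_def by (rule finite_subset[of _ "Pow {1..n}"]) auto
  have split: "{A \<in> Pow {1..n}. j \<le> card A \<or> A \<subseteq> {1..<j}} = (\<Union>k\<in>{j..n}. L k) \<union> Pow {1..<j}"
  proof (intro equalityI subsetI)
    fix A assume A: "A \<in> {A \<in> Pow {1..n}. j \<le> card A \<or> A \<subseteq> {1..<j}}"
    then have "card A \<le> n" using card_mono[of "{1..n}" A] by simp
    with A show "A \<in> (\<Union>k\<in>{j..n}. L k) \<union> Pow {1..<j}"
      by (auto simp: L_def)
  next
    have "{1..<j} \<subseteq> {1..n}" using j by auto
    moreover fix A assume "A \<in> (\<Union>k\<in>{j..n}. L k) \<union> Pow {1..<j}"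
    ultimately show "A \<in> {A \<in> Pow {1..n}. j \<le> card A \<or> A \<subseteq> {1..<j}}"
      by (elim UnE UN_E) (auto simp: L_def)
  qed
  have "A \<notin> Pow {1..<j}" if "A \<in> (\<Union>k\<in>{j..n}. L k)" for A
  proof
    assume "A \<in> Pow {1..<j}"
    then have "card A \<le> j - 1" using card_mono[of "{1..<j}" A] by simp
    moreover have "j \<le> card A" using that by (auto simp: L_def)
    ultimately show False using j by auto
  qed
  then have "(\<Union>k\<in>{j..n}. L k) \<inter> Pow {1..<j} = {}"
    by (simp only: disjoint_iff) simp
  then have "card ((\<Union>k\<in>{j..n}. L k) \<union> Pow {1..<j}) = card (\<Union>k\<in>{j..n}. L k) + card (Pow {1..<j})"
    using fin by (intro card_Un_disjoint) simp_all
  moreover have "card (\<Union>k\<in>{j..n}. L k) = (\<Sum>k=j..n. card (L k))"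
    using fin by (intro card_UN_disjoint) (auto simp: L_def)
  moreover have "card (L k) = n choose k" for k
    unfolding L_def using n_subsets[of "{1..n}" k] by simp
  ultimately show ?thesis
    unfolding split by (simp add: card_Pow)
qed

text \<open>Since m is the cardinality of the first block's image, the record criterion depends on
  that subset alone and so passes through the bijection. The summand n is the overcount at the
  identity, for which every position is a record.\<close>

lemma card_Grassmannian_records:
  assumes j: "j \<in> {1..n}"
  shows "card (Grassmannian n \<inter> records j) + n = (\<Sum>k=j..n. n choose k) + 2 ^ (j - 1)"
proof -
  let ?f = "\<lambda>(w, m). w ` {1..m}"
  let ?P = "SIGMA w:Grassmannian n. cuts n w"
  let ?R = "SIGMA w:Grassmannian n \<inter> records j. cuts n w"
  have card_f: "card (w ` {1..m}) = m" if "w \<in> Sym n" for w m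
    using Sym_inj[OF that] by (simp add: card_image inj_on_subset)
  have image_Collect: "g ` {p \<in> P. Q (g p)} = {A \<in> g ` P. Q A}"
    for g :: "(nat \<Rightarrow> nat) \<times> nat \<Rightarrow> nat set" and P Q
    by blast
  have "?f ` ?R = {A \<in> Pow {1..n}. j \<le> card A \<or> A \<subseteq> {1..<j}}"
  proof -
    have "?R = {p \<in> ?P. j \<le> card (?f p) \<or> ?f p \<subseteq> {1..<j}}"
    proof -
      have rec: "w \<in> records j \<longleftrightarrow> j \<le> card (w ` {1..m}) \<or> w ` {1..m} \<subseteq> {1..<j}"
        if "w \<in> Grassmannian n" "m \<in> cuts n w" for w m
        using records_cut_iff[OF _ that(2) j] that(1) card_f[of w m] by (simp add: Grassmannian_iff)
      have mem: "p \<in> ?R \<longleftrightarrow> p \<in> ?P \<and> (j \<le> card (?f p) \<or> ?f p \<subseteq> {1..<j})" for p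
      proof (cases p)
        case (Pair w m)
        show ?thesis
          using rec[of w m] unfolding Pair mem_Sigma_iff Int_iff prod.case
          by (cases "w \<in> Grassmannian n"; cases "m \<in> cuts n w") (simp_all only: simp_thms)
      qed
      show ?thesis
        by (rule set_eqI, unfold mem_Collect_eq, rule mem)
    qed
    then have "?f ` ?R = ?f ` {p \<in> ?P. j \<le> card (?f p) \<or> ?f p \<subseteq> {1..<j}}"
      by (rule arg_cong)
    also have "\<dots> = {A \<in> ?f ` ?P. j \<le> card A \<or> A \<subseteq> {1..<j}}"
      by (rule image_Collect[of ?f ?P "\<lambda>A. j \<le> card A \<or> A \<subseteq> {1..<j}"])
    finally show ?thesis
      by (simp only: bij_betw_imp_surj_on[OF bij_betw_cuts_Pow])
  qed
  moreover have "inj_on ?f ?R"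
    by (rule inj_on_subset[OF bij_betw_imp_inj_on[OF bij_betw_cuts_Pow[of n]]]) auto
  ultimately have "card ?R = card {A \<in> Pow {1..n}. j \<le> card A \<or> A \<subseteq> {1..<j}}"
    using card_image[of ?f ?R] by (simp only:)
  then have "card ?R = (\<Sum>k=j..n. n choose k) + 2 ^ (j - 1)"
    unfolding card_large_or_initial_subsets[OF j] .
  moreover have "card ?R = card (Grassmannian n \<inter> records j) + n"
    by (rule card_Grassmannian_cuts) (simp add: mem_records_iff)
  ultimately show ?thesis by metis
qed

section \<open>Boolean permutations\<close>

lemma word_product_Nil: "word_product [] = id"
  by (simp add: word_product_def)

lemma word_product_Cons: "word_product (i # is) = simple_transposition i \<circ> word_product is"
  by (simp add: word_product_def)

lemma word_product_append: "word_product (is @ js) = word_product is \<circ> word_product js"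
  by (induction "is") (simp_all add: word_product_Nil word_product_Cons o_assoc)

lemma simple_transposition_in_Sym: "i \<in> {1..<n} \<Longrightarrow> simple_transposition i \<in> Sym n"
  by (auto simp: Sym_def simple_transposition_def intro: permutes_swap_id)

lemma Sym_comp: "v \<in> Sym n \<Longrightarrow> w \<in> Sym n \<Longrightarrow> v \<circ> w \<in> Sym n"
  by (simp add: Sym_def permutes_compose)

lemma word_product_in_Sym: "set is \<subseteq> {1..<n} \<Longrightarrow> word_product is \<in> Sym n"
  by (induction "is")
    (simp_all add: word_product_Nil word_product_Cons id_in_Sym Sym_comp simple_transposition_in_Sym)

lemma Boolean_iff:
  "w \<in> Boolean n \<longleftrightarrow> (\<exists>is. set is \<subseteq> {1..<n} \<and> distinct is \<and> w = word_product is)"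
  by (auto simp: Boolean_def word_product_in_Sym)

lemma Boolean_subset_Sym: "Boolean n \<subseteq> Sym n"
  by (auto simp: Boolean_def)

text \<open>The supports are disjoint: \<open>v\<close> fixes n + 1 and n + 2, the only points that
  the transposition moves.\<close>

lemma simple_transposition_commute:
  assumes "v \<in> Sym n"
  shows "v \<circ> simple_transposition (Suc n) = simple_transposition (Suc n) \<circ> v"
proof
  fix x
  have "v (Suc n) = Suc n" "v (Suc (Suc n)) = Suc (Suc n)"
    using Sym_fixed[OF assms] by simp_all
  moreover have "v x = Suc n \<longleftrightarrow> x = Suc n" "v x = Suc (Suc n) \<longleftrightarrow> x = Suc (Suc n)"
    using calculation inj_eq[OF Sym_inj[OF assms], of x "Suc n"]
      inj_eq[OF Sym_inj[OF assms], of x "Suc (Suc n)"] by simp_all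
  ultimately show "(v \<circ> simple_transposition (Suc n)) x = (simple_transposition (Suc n) \<circ> v) x"
    by (auto simp: simple_transposition_def Transposition.transpose_def)
qed

lemma Boolean_mono: "m \<le> n \<Longrightarrow> Boolean m \<subseteq> Boolean n"
proof
  fix w assume "m \<le> n" "w \<in> Boolean m"
  then obtain "is" where "set is \<subseteq> {1..<m}" "distinct is" "w = word_product is"
    by (auto simp: Boolean_iff)
  moreover have "{1..<m} \<subseteq> {1..<n}" using \<open>m \<le> n\<close> by auto
  ultimately show "w \<in> Boolean n" unfolding Boolean_iff by blast
qed

text \<open>Without the generator n, the only neighbour of n + 1 available, the word uses generators
  below n and its product lies in \<open>Sym n\<close>.\<close>

lemma word_product_commute:
  assumes "set is \<subseteq> {1..<Suc n}" and "n \<notin> set is"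
  shows "word_product is \<circ> simple_transposition (Suc n) = simple_transposition (Suc n) \<circ> word_product is"
proof (rule simple_transposition_commute[of _ n], rule word_product_in_Sym)
  show "set is \<subseteq> {1..<n}"
    using assms by (fastforce simp: less_Suc_eq)
qed

text \<open>The last generator can be moved to one end of the word, since the only generator that does
  not commute with it occurs on one side only.\<close>

lemma Boolean_Suc:
  "Boolean (Suc (Suc n)) = Boolean (Suc n)
     \<union> (\<lambda>u. u \<circ> simple_transposition (Suc n)) ` Boolean (Suc n)
     \<union> (\<lambda>u. simple_transposition (Suc n) \<circ> u) ` Boolean (Suc n)"
    (is "_ = _ \<union> ?R \<union> ?L")
proof (intro equalityI subsetI)
  fix w assume "w \<in> Boolean (Suc (Suc n))"
  then obtain "is" where "is": "set is \<subseteq> {1..<Suc (Suc n)}" "distinct is" "w = word_product is"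
    by (auto simp: Boolean_iff)
  show "w \<in> Boolean (Suc n) \<union> ?R \<union> ?L"
  proof (cases "Suc n \<in> set is")
    case False
    then have "set is \<subseteq> {1..<Suc n}"
      using "is"(1) by (fastforce simp: less_Suc_eq)
    then show ?thesis using "is" by (auto simp: Boolean_iff)
  next
    case True
    then obtain xs ys where xy: "is = xs @ Suc n # ys" by (meson split_list)
    have sub: "set xs \<subseteq> {1..<Suc n}" "set ys \<subseteq> {1..<Suc n}"
      using "is"(1,2) xy by (fastforce simp: less_Suc_eq)+
    have "set (xs @ ys) \<subseteq> {1..<Suc n}" "distinct (xs @ ys)"
      using "is"(2) xy sub by auto
    then have mem: "word_product (xs @ ys) \<in> Boolean (Suc n)"
      unfolding Boolean_iff by blast
    have w: "w = word_product xs \<circ> simple_transposition (Suc n) \<circ> word_product ys"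
      using "is"(3) xy by (simp add: word_product_append word_product_Cons o_assoc)
    show ?thesis
    proof (cases "n \<in> set xs")
      case True
      then have "n \<notin> set ys" using "is"(2) xy by auto
      then have "w = word_product (xs @ ys) \<circ> simple_transposition (Suc n)"
        using w word_product_commute[OF sub(2)] by (simp add: word_product_append o_assoc[symmetric])
      then show ?thesis using mem by blast
    next
      case False
      then have "w = simple_transposition (Suc n) \<circ> word_product (xs @ ys)"
        using w word_product_commute[OF sub(1)] by (simp add: word_product_append o_assoc)
      then show ?thesis using mem by blast
    qed
  qed
next
  fix w assume "w \<in> Boolean (Suc n) \<union> ?R \<union> ?L"
  then consider "w \<in> Boolean (Suc n)" | "w \<in> ?R" | "w \<in> ?L" by blast
  then show "w \<in> Boolean (Suc (Suc n))"
  proof cases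
    case 1
    then show ?thesis using Boolean_mono[of "Suc n" "Suc (Suc n)"] by auto
  next
    case 2
    then obtain "is" where *: "set is \<subseteq> {1..<Suc n}" "distinct is"
      "w = word_product is \<circ> simple_transposition (Suc n)"
      by (auto simp: Boolean_iff)
    then have "w = word_product (is @ [Suc n])"
      by (simp add: word_product_append word_product_Cons word_product_Nil)
    moreover have "set (is @ [Suc n]) \<subseteq> {1..<Suc (Suc n)}" "distinct (is @ [Suc n])"
      using * by auto
    ultimately show ?thesis unfolding Boolean_iff by blast
  next
    case 3
    then obtain "is" where *: "set is \<subseteq> {1..<Suc n}" "distinct is"
      "w = simple_transposition (Suc n) \<circ> word_product is"
      by (auto simp: Boolean_iff)
    then have "w = word_product (Suc n # is)"
      by (simp add: word_product_Cons)
    moreover have "set (Suc n # is) \<subseteq> {1..<Suc (Suc n)}" "distinct (Suc n # is)"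
      using * by auto
    ultimately show ?thesis unfolding Boolean_iff by blast
  qed
qed

section \<open>Multiplication by the last generator on either side\<close>

lemma Sym_comp_simple_transposition:
  assumes "u \<in> Sym (Suc n)"
  shows "x \<le> n \<Longrightarrow> (u \<circ> simple_transposition (Suc n)) x = u x"
    and "(u \<circ> simple_transposition (Suc n)) (Suc n) = Suc (Suc n)"
    and "(u \<circ> simple_transposition (Suc n)) (Suc (Suc n)) = u (Suc n)"
  using Sym_fixed[OF assms, of "Suc (Suc n)"]
  by (auto simp: simple_transposition_def Transposition.transpose_def)

text \<open>Multiplication on the left swaps the values n + 1 and n + 2, and \<open>u\<close> has n
  + 2 in the last position.\<close>

lemma simple_transposition_comp_Sym:
  assumes "u \<in> Sym (Suc n)"
  shows "(simple_transposition (Suc n) \<circ> u) (Suc (Suc n)) = Suc n"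
    and "(simple_transposition (Suc n) \<circ> u) x = Suc (Suc n) \<longleftrightarrow> u x = Suc n"
  using Sym_fixed[OF assms, of "Suc (Suc n)"]
  by (auto simp: simple_transposition_def Transposition.transpose_def)

lemma Sym_le: "u \<in> Sym n \<Longrightarrow> x \<le> n \<Longrightarrow> u x \<le> n"
  using Sym_in_iff[of u n x] Sym_fixed[of u n x] by (cases "x = 0") auto

text \<open>By \<open>Boolean_Suc\<close>, an element that needs the last generator has
  \<open>u (Suc m)\<close> or \<open>Suc m\<close> as its last value, and both are smaller than
  \<open>Suc (Suc m)\<close>.\<close>

lemma Boolean_fixed_last:
  assumes "v \<in> Boolean (Suc n)" and "v (Suc n) = Suc n"
  shows "v \<in> Boolean n"
proof (cases n)
  case 0
  then show ?thesis using assms by (auto simp: Boolean_iff)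
next
  case (Suc m)
  have "u (Suc m) \<noteq> Suc (Suc m)" if "u \<in> Boolean (Suc m)" for u
    using Sym_le[of u "Suc m" "Suc m"] that Boolean_subset_Sym by fastforce
  then show ?thesis
    using assms Boolean_subset_Sym unfolding Suc Boolean_Suc
    by (auto simp: Sym_comp_simple_transposition(3) simple_transposition_comp_Sym(1) subset_iff simp del: comp_apply)
qed

text \<open>Let u s = s v. The left side takes the value n + 2 at position n + 1, the right side
  takes it only where \<open>v\<close> takes n + 1. So \<open>v\<close> fixes n + 1, hence lies in
  \<open>Boolean n\<close>, and commutes with s. Conversely, all of \<open>Boolean n\<close>
  commutes with s.\<close>

lemma Boolean_Int:
  "(\<lambda>u. u \<circ> simple_transposition (Suc n)) ` Boolean (Suc n)
     \<inter> (\<lambda>u. simple_transposition (Suc n) \<circ> u) ` Boolean (Suc n)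
   = (\<lambda>u. u \<circ> simple_transposition (Suc n)) ` Boolean n"
proof (intro equalityI subsetI)
  fix w
  assume "w \<in> (\<lambda>u. u \<circ> simple_transposition (Suc n)) ` Boolean (Suc n)
     \<inter> (\<lambda>u. simple_transposition (Suc n) \<circ> u) ` Boolean (Suc n)"
  then obtain u v where uv: "u \<in> Boolean (Suc n)" "v \<in> Boolean (Suc n)"
    "w = u \<circ> simple_transposition (Suc n)" "w = simple_transposition (Suc n) \<circ> v"
    by blast
  then have S: "u \<in> Sym (Suc n)" "v \<in> Sym (Suc n)" using Boolean_subset_Sym by blast+
  then have "v (Suc n) = Suc n"
    using uv(3,4) Sym_comp_simple_transposition(2) simple_transposition_comp_Sym(2) by metis
  then have "v \<in> Boolean n" using uv Boolean_fixed_last by blast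
  moreover from this have "w = v \<circ> simple_transposition (Suc n)"
    using uv simple_transposition_commute Boolean_subset_Sym by (metis subset_iff)
  ultimately show "w \<in> (\<lambda>u. u \<circ> simple_transposition (Suc n)) ` Boolean n" by blast
next
  fix w assume "w \<in> (\<lambda>u. u \<circ> simple_transposition (Suc n)) ` Boolean n"
  then obtain v where v: "v \<in> Boolean n" "w = v \<circ> simple_transposition (Suc n)" by blast
  moreover have "w = simple_transposition (Suc n) \<circ> v"
    using v simple_transposition_commute Boolean_subset_Sym by (metis subset_iff)
  moreover have "v \<in> Boolean (Suc n)" using v Boolean_mono[of n "Suc n"] by auto
  ultimately show "w \<in> (\<lambda>u. u \<circ> simple_transposition (Suc n)) ` Boolean (Suc n)
     \<inter> (\<lambda>u. simple_transposition (Suc n) \<circ> u) ` Boolean (Suc n)"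
    by blast
qed

text \<open>Inclusion-exclusion for \<open>Boolean_Suc\<close>, restricted to \<open>Q\<close>; as
  multiplication by s is injective, each part is counted by its factors \<open>u\<close>. Keeping
  \<open>Q\<close> arbitrary serves the total and the record counts at once.\<close>

lemma card_Boolean_Suc_Int:
  fixes Q :: "(nat \<Rightarrow> nat) set"
  defines "s \<equiv> \<lambda>n. simple_transposition (Suc n)"
  shows "card (Boolean (Suc (Suc n)) \<inter> Q) + card {u \<in> Boolean n. u \<circ> s n \<in> Q}
    = card (Boolean (Suc n) \<inter> Q) + card {u \<in> Boolean (Suc n). u \<circ> s n \<in> Q}
        + card {u \<in> Boolean (Suc n). s n \<circ> u \<in> Q}"
proof -
  let ?B = "Boolean (Suc n)"
  let ?R = "(\<lambda>u. u \<circ> s n) ` {u \<in> ?B. u \<circ> s n \<in> Q}"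
  let ?L = "(\<lambda>u. s n \<circ> u) ` {u \<in> ?B. s n \<circ> u \<in> Q}"
  let ?I = "(\<lambda>u. u \<circ> s n) ` {u \<in> Boolean n. u \<circ> s n \<in> Q}"
  have invol: "s n (s n x) = x" for x
    by (simp add: s_def simple_transposition_def)
  have inj: "inj (\<lambda>u. u \<circ> s n)" "inj (\<lambda>u. s n \<circ> u)"
  proof -
    show "inj (\<lambda>u. u \<circ> s n)"
      by (rule inj_on_inverseI[where g = "\<lambda>u. u \<circ> s n"]) (simp add: fun_eq_iff invol)
    show "inj (\<lambda>u. s n \<circ> u)"
      by (rule inj_on_inverseI[where g = "\<lambda>u. s n \<circ> u"]) (simp add: fun_eq_iff invol)
  qed
  have cards: "card ?R = card {u \<in> ?B. u \<circ> s n \<in> Q}" "card ?L = card {u \<in> ?B. s n \<circ> u \<in> Q}"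
    "card ?I = card {u \<in> Boolean n. u \<circ> s n \<in> Q}"
    by (intro card_image inj_on_subset[OF inj(1)] inj_on_subset[OF inj(2)] subset_UNIV)+
  have fin: "finite ?R" "finite ?L" "finite (?B \<inter> Q)"
    using finite_Boolean by simp_all
  have image_Int: "f ` {u \<in> A. f u \<in> Q} = f ` A \<inter> Q" for f :: "(nat \<Rightarrow> nat) \<Rightarrow> nat \<Rightarrow> nat" and A
    by blast
  have "Boolean (Suc (Suc n)) \<inter> Q = (?B \<inter> Q) \<union> (?R \<union> ?L)"
    unfolding Boolean_Suc s_def image_Int by (simp only: Int_Un_distrib2 Un_assoc)
  \<comment> \<open>The point n + 2 separates the parts: \<open>?B\<close> fixes it, while every
    product with s moves it.\<close>
  moreover have "(?B \<inter> Q) \<inter> (?R \<union> ?L) = {}"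
  proof -
    have S: "u \<in> Sym (Suc n)" if "u \<in> ?B" for u
      using that Boolean_subset_Sym by blast
    have fixed: "u (Suc (Suc n)) = Suc (Suc n)" if "u \<in> ?B" for u
      using Sym_fixed[OF S[OF that]] by simp
    have R: "(u \<circ> s n) (Suc (Suc n)) \<noteq> Suc (Suc n)" if "u \<in> ?B" for u
      using Sym_le[OF S[OF that], of "Suc n"]
      unfolding s_def Sym_comp_simple_transposition(3)[OF S[OF that]] by simp
    have L: "(s n \<circ> u) (Suc (Suc n)) \<noteq> Suc (Suc n)" if "u \<in> ?B" for u
      unfolding s_def simple_transposition_comp_Sym(1)[OF S[OF that]] by simp
    have "w (Suc (Suc n)) \<noteq> Suc (Suc n)" if w: "w \<in> ?R \<union> ?L" for w
      using w
    proof (elim UnE imageE CollectE conjE)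
      fix u assume "w = u \<circ> s n" "u \<in> ?B"
      then show ?thesis using R by (simp only: not_False_eq_True)
    next
      fix u assume "w = s n \<circ> u" "u \<in> ?B"
      then show ?thesis using L by (simp only: not_False_eq_True)
    qed
    with fixed show ?thesis by (meson Int_iff disjoint_iff)
  qed
  moreover have "?R \<inter> ?L = ?I"
  proof -
    have "(X \<inter> Q) \<inter> (Y \<inter> Q) = (X \<inter> Y) \<inter> Q" for X Y
      by blast
    then show ?thesis
      by (simp only: image_Int s_def Boolean_Int)
  qed
  ultimately show ?thesis
    using fin cards card_Un_disjoint[of "?B \<inter> Q" "?R \<union> ?L"] card_Un_Int[of ?R ?L] by simp
qed

lemma card_Boolean_Suc_Suc:
  "card (Boolean (Suc (Suc n))) + card (Boolean n) = 3 * card (Boolean (Suc n))"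
  using card_Boolean_Suc_Int[of n UNIV] by simp

text \<open>In one-line notation, the product inserts the new maximum n + 2 just before the last
  entry of \<open>u\<close>. Earlier positions keep their history, the maximum is a record, and the
  entry after it is not.\<close>

lemma records_comp_simple_transposition:
  assumes "u \<in> Sym (Suc n)"
  shows "j \<le> n \<Longrightarrow> u \<circ> simple_transposition (Suc n) \<in> records j \<longleftrightarrow> u \<in> records j"
    and "u \<circ> simple_transposition (Suc n) \<in> records (Suc n)"
    and "u \<circ> simple_transposition (Suc n) \<notin> records (Suc (Suc n))"
proof -
  have le: "u k \<le> Suc n" if "k \<le> Suc n" for k
    using Sym_le[OF assms that] .
  note eqs = Sym_comp_simple_transposition[OF assms]
  show "u \<circ> simple_transposition (Suc n) \<in> records j \<longleftrightarrow> u \<in> records j" if "j \<le> n"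
    unfolding mem_records_iff using that by (intro ball_cong refl) (simp add: eqs del: comp_apply)
  show "u \<circ> simple_transposition (Suc n) \<in> records (Suc n)"
    unfolding mem_records_iff eqs(2) using le by (auto simp: eqs(1) le_SucI simp del: comp_apply)
  have "(u \<circ> simple_transposition (Suc n)) (Suc n) > (u \<circ> simple_transposition (Suc n)) (Suc (Suc n))"
    unfolding eqs(2,3) using le[of "Suc n"] by simp
  then show "u \<circ> simple_transposition (Suc n) \<notin> records (Suc (Suc n))"
    unfolding mem_records_iff by (auto simp del: comp_apply intro!: bexI[of _ "Suc n"])
qed

text \<open>On the first n + 1 positions the value n + 1 is merely raised to n + 2, which preserves
  all comparisons. The last entry becomes n + 1 and is preceded by n + 2.\<close>

lemma records_simple_transposition_comp:
  assumes "u \<in> Sym (Suc n)"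
  shows "j \<le> Suc n \<Longrightarrow> simple_transposition (Suc n) \<circ> u \<in> records j \<longleftrightarrow> u \<in> records j"
    and "simple_transposition (Suc n) \<circ> u \<notin> records (Suc (Suc n))"
proof -
  have "simple_transposition (Suc n) x \<le> simple_transposition (Suc n) y \<longleftrightarrow> x \<le> y"
    if "x \<le> Suc n" "y \<le> Suc n" for x y
    using that by (auto simp: simple_transposition_def Transposition.transpose_def)
  then show "simple_transposition (Suc n) \<circ> u \<in> records j \<longleftrightarrow> u \<in> records j" if "j \<le> Suc n"
    unfolding mem_records_iff using that Sym_le[OF assms] by (intro ball_cong refl) simp
  have "Suc n \<in> u ` {1..Suc n}" using Sym_image[OF assms] by simp
  then obtain k where k: "k \<in> {1..<Suc (Suc n)}" "u k = Suc n" by fastforce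
  then have "(simple_transposition (Suc n) \<circ> u) k = Suc (Suc n)"
    using simple_transposition_comp_Sym(2)[OF assms] by blast
  then have "(simple_transposition (Suc n) \<circ> u) k > (simple_transposition (Suc n) \<circ> u) (Suc (Suc n))"
    by (simp add: simple_transposition_comp_Sym(1)[OF assms] del: comp_apply)
  then show "simple_transposition (Suc n) \<circ> u \<notin> records (Suc (Suc n))"
    unfolding mem_records_iff using k(1) not_less by blast
qed

text \<open>Up to position n, neither multiplication affects the record, so every term of the
  inclusion-exclusion counts the same event.\<close>

lemma card_Boolean_records_step:
  assumes "j \<le> n"
  shows "card (Boolean (Suc (Suc n)) \<inter> records j) + card (Boolean n \<inter> records j)
    = 3 * card (Boolean (Suc n) \<inter> records j)"
proof -
  let ?s = "simple_transposition (Suc n)"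
  have S: "u \<in> Sym (Suc n)" if "u \<in> Boolean n \<or> u \<in> Boolean (Suc n)" for u
    using that Boolean_subset_Sym Sym_mono[of n "Suc n"] by fastforce
  have "{u \<in> Boolean m. u \<circ> ?s \<in> records j} = Boolean m \<inter> records j" if "m \<in> {n, Suc n}" for m
    using records_comp_simple_transposition(1)[OF S assms] that by blast
  moreover have "{u \<in> Boolean (Suc n). ?s \<circ> u \<in> records j} = Boolean (Suc n) \<inter> records j"
    using records_simple_transposition_comp(1)[OF S] assms by fastforce
  ultimately show ?thesis
    using card_Boolean_Suc_Int[of n "records j"] by simp
qed

text \<open>The last position is a record exactly for the elements that do without the last
  generator, since these fix it. For n = 0 there is no generator to split off.\<close>

lemma card_Boolean_records_last:
  "card (Boolean (Suc n) \<inter> records (Suc n)) = card (Boolean n)"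
proof (cases n)
  case 0
  have "Boolean 0 = {id}" "Boolean (Suc 0) = {id}"
    by (auto simp: Boolean_iff word_product_Nil)
  then show ?thesis using 0 by (simp add: mem_records_iff)
next
  case (Suc m)
  have S: "u \<in> Sym (Suc m)" if "u \<in> Boolean m \<or> u \<in> Boolean (Suc m)" for u
    using that Boolean_subset_Sym Sym_mono[of m "Suc m"] by fastforce
  let ?s = "simple_transposition (Suc m)"
  have "{u \<in> Boolean m. u \<circ> ?s \<in> records (Suc (Suc m))} = {}"
    "{u \<in> Boolean (Suc m). u \<circ> ?s \<in> records (Suc (Suc m))} = {}"
    "{u \<in> Boolean (Suc m). ?s \<circ> u \<in> records (Suc (Suc m))} = {}"
    using records_comp_simple_transposition(3)[OF S] records_simple_transposition_comp(2)[OF S]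
    by blast+
  moreover have "Boolean (Suc m) \<inter> records (Suc (Suc m)) = Boolean (Suc m)"
  proof -
    have "u \<in> records (Suc (Suc m))" if "u \<in> Boolean (Suc m)" for u
      using Sym_le[OF S, of u] Sym_fixed[OF S, of u "Suc (Suc m)"] that
      by (simp add: mem_records_iff le_SucI)
    then show ?thesis by blast
  qed
  ultimately show ?thesis
    using card_Boolean_Suc_Int[of m "records (Suc (Suc m))"] Suc by (simp only: card.empty add_0_right)
qed

text \<open>Right multiples always have this record. The elements of \<open>Boolean (Suc n)\<close>
  and the left multiples have it as often as \<open>Boolean (Suc n)\<close> has a record in its own
  last position, and one of these two contributions cancels against the intersection.\<close>

lemma card_Boolean_records_penultimate:
  "card (Boolean (Suc (Suc n)) \<inter> records (Suc n)) = card (Boolean (Suc n)) + card (Boolean n)"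
proof -
  let ?s = "simple_transposition (Suc n)"
  have S: "u \<in> Sym (Suc n)" if "u \<in> Boolean n \<or> u \<in> Boolean (Suc n)" for u
    using that Boolean_subset_Sym Sym_mono[of n "Suc n"] by fastforce
  have "{u \<in> Boolean m. u \<circ> ?s \<in> records (Suc n)} = Boolean m" if "m \<in> {n, Suc n}" for m
    using records_comp_simple_transposition(2)[OF S] that by blast
  moreover have "{u \<in> Boolean (Suc n). ?s \<circ> u \<in> records (Suc n)} = Boolean (Suc n) \<inter> records (Suc n)"
    using records_simple_transposition_comp(1)[OF S] by fastforce
  ultimately show ?thesis
    using card_Boolean_Suc_Int[of n "records (Suc n)"] card_Boolean_records_last[of n] by simp
qed

section \<open>Fibonacci numbers at integer indices\<close>

lemma golden_ratio_powers:
  "golden_ratio ^ 2 = golden_ratio + 1" "golden_ratio > 0"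
  "golden_ratio * ((1 - sqrt 5) / 2) = -1"
  "golden_ratio ^ 3 = sqrt 5 + 2"
  by (simp_all add: golden_ratio_def power2_eq_square power3_eq_cube field_simps add_pos_pos)

text \<open>The conjugate root is -1/\<phi>, so its powers are signed powers of \<phi>. The sign in
  the extension to negative indices is the one that keeps Binet's formula valid there.\<close>

lemma fib_int_Binet:
  "real_of_int (fib_int m) = (golden_ratio powi m - (-1) powi m * golden_ratio powi (-m)) / sqrt 5"
proof -
  have psi: "(1 - sqrt 5) / 2 = - inverse golden_ratio"
    using golden_ratio_powers(2,3) by (simp add: field_simps)
  have nat: "real (fib k) = (golden_ratio ^ k - (-1) ^ k * inverse golden_ratio ^ k) / sqrt 5" for k
    using fib_closed_form[of k, folded golden_ratio_def] psi
    by (simp flip: power_mult_distrib)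
  show ?thesis
  proof (cases "m \<ge> 0")
    case True
    then obtain k where "m = int k" by (metis nonneg_int_cases)
    then show ?thesis using nat[of k] by (simp add: fib_int_def power_int_minus power_inverse)
  next
    case False
    then obtain k where k: "m = - int k" "k > 0" by (metis neg_int_cases not_le)
    then show ?thesis
      using nat[of k]
      by (cases "even k") (simp_all add: fib_int_def power_int_minus power_inverse divide_inverse algebra_simps)
  qed
qed

text \<open>Derived from Binet's formula, which spares a case distinction on the signs of the three
  indices.\<close>

lemma fib_int_rec: "fib_int (m + 2) = fib_int (m + 1) + fib_int m"
proof -
  have "golden_ratio powi (m + 2) = golden_ratio powi (m + 1) + golden_ratio powi m"
    using golden_ratio_powers(1,2) by (simp add: power_int_add algebra_simps)
  \<comment> \<open>The equation \<phi>^2 = \<phi> + 1 multiplied by \<phi>^(-(m + 2)).\<close>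
  moreover have "golden_ratio powi (- m) = golden_ratio powi (- (m+1)) + golden_ratio powi (-(m+2))"
  proof -
    have "golden_ratio powi (- m) = golden_ratio powi (-(m+2)) * golden_ratio ^ 2"
      "golden_ratio powi (- (m+1)) = golden_ratio powi (-(m+2)) * golden_ratio"
      using golden_ratio_powers(2) power_int_add[of golden_ratio "-(m+2)" 2]
        power_int_add[of golden_ratio "-(m+2)" 1] by (simp_all add: algebra_simps)
    then show ?thesis using golden_ratio_powers(1) by (simp add: algebra_simps)
  qed
  moreover have "(-1::real) powi (m+2) = (-1) powi m" "(-1::real) powi (m+1) = - ((-1) powi m)"
    by (simp_all add: power_int_add)
  ultimately have "real_of_int (fib_int (m + 2)) = real_of_int (fib_int (m + 1) + fib_int m)"
    unfolding of_int_add fib_int_Binet by (simp add: field_simps)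
  then show ?thesis by linarith
qed

text \<open>Eliminates the terms at m + 1 and m + 3 from three consecutive instances of the
  recurrence.\<close>

lemma fib_int_step2: "fib_int (m + 4) = 3 * fib_int (m + 2) - fib_int m"
  using fib_int_rec[of m] fib_int_rec[of "m+1"] fib_int_rec[of "m+2"] by (simp add: algebra_simps)

lemma fib_int_quotient_golden_ratio:
  fixes n j :: int
  shows "(real_of_int (fib_int (2 * n - 2)) - of_int (fib_int (2 * j - 4)) * of_int (fib_int (2 * (n - j) - 1)))
          / of_int (fib_int (2 * n - 1))
    = (2 * golden_ratio powi (2 * n - 2) + 2 * golden_ratio powi (2 - 2 * n)
            + golden_ratio powi (2 * n - 4 * j + 3) - golden_ratio powi (4 * j - 2 * n - 3))
          / (sqrt 5 * (golden_ratio powi (2 * n - 1) + golden_ratio powi (1 - 2 * n)))"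
proof -
  let ?p = "\<lambda>m. golden_ratio powi m"
  have mult: "?p a * ?p b = ?p (a + b)" for a b
    using golden_ratio_powers(2) by (simp add: power_int_add)
  \<comment> \<open>Gives numerator and denominator the common factor 1/5, which cancels at the
    end.\<close>
  have sqrt5: "x / sqrt 5 = sqrt 5 * x / 5" for x :: real
  proof -
    have "x / sqrt 5 = x * (sqrt 5 / 5)"
      by (simp only: divide_inverse[of x] sqrt_divide_self_eq zero_le_numeral)
    then show ?thesis by simp
  qed
  have even: "of_int (fib_int m) = (?p m - ?p (- m)) / sqrt 5" if "even m" for m
    using that by (simp add: fib_int_Binet power_int_minus_left)
  have odd: "of_int (fib_int m) = (?p m + ?p (- m)) / sqrt 5" if "odd m" for m
    using that by (simp add: fib_int_Binet power_int_minus_left)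
  \<comment> \<open>The product of Fibonacci numbers produces the exponents 2n - 5 and 5 - 2n, which
    the target lacks. The factor \<phi>^3 = sqrt 5 + 2 turns them into 2n - 2 and 2 - 2n; in the
    numerator the sqrt 5 parts then cancel and the 2 remains as coefficient.\<close>
  have a: "?p (5 - 2 * n) = ?p (2 - 2 * n) * (sqrt 5 + 2)"
    using mult[of "2 - 2 * n" 3] golden_ratio_powers(4) by simp
  have b: "?p (2 * n - 2) = ?p (2 * n - 5) * (sqrt 5 + 2)"
    using mult[of "2 * n - 5" 3] golden_ratio_powers(4) by simp
  have b': "?p (2 * n - 5) = ?p (2 * n - 2) * (sqrt 5 - 2)"
    unfolding b by (simp add: algebra_simps)
  have prod: "real_of_int (fib_int (2 * j - 4)) * of_int (fib_int (2 * (n - j) - 1))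
      = (?p (2 * n - 5) + ?p (4 * j - 2 * n - 3) - ?p (2 * n - 4 * j + 3) - ?p (5 - 2 * n)) / 5"
  proof -
    have "real_of_int (fib_int (2 * j - 4)) * of_int (fib_int (2 * (n - j) - 1))
      = (?p (2 * j - 4) - ?p (- (2 * j - 4))) * (?p (2 * (n - j) - 1) + ?p (- (2 * (n - j) - 1))) / 5"
      by (subst even, simp, subst odd, simp) simp
    then show ?thesis
      by (simp add: ring_distribs mult) (simp add: algebra_simps)
  qed
  have num: "real_of_int (fib_int (2 * n - 2)) - of_int (fib_int (2 * j - 4)) * of_int (fib_int (2 * (n - j) - 1))
    = (2 * ?p (2 * n - 2) + 2 * ?p (2 - 2 * n) + ?p (2 * n - 4 * j + 3) - ?p (4 * j - 2 * n - 3)) / 5"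
  proof -
    have "real_of_int (fib_int (2 * n - 2)) = sqrt 5 * (?p (2 * n - 2) - ?p (2 - 2 * n)) / 5"
      by (subst even) (simp_all add: sqrt5)
    then show ?thesis unfolding prod a b' by argo
  qed
  have den: "real_of_int (fib_int (2 * n - 1)) = sqrt 5 * (?p (2 * n - 1) + ?p (1 - 2 * n)) / 5"
    by (subst odd) (simp_all add: sqrt5)
  have "(a / 5) / (b / 5) = a / b" for a b :: real
    by simp
  then show ?thesis
    by (simp only: num den)
qed

section \<open>Counting Boolean permutations\<close>

lemma card_Boolean: "int (card (Boolean n)) = fib_int (2 * int n - 1)"
proof (induction n rule: fib.induct)
  case 1
  \<comment> \<open>Here the Fibonacci index is -1, and its value is 1 by the extension to negative
    indices.\<close>
  have "Boolean 0 = {id}" by (auto simp: Boolean_iff word_product_Nil)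
  then show ?case by (simp add: fib_int_def)
next
  case 2
  have "Boolean (Suc 0) = {id}" by (auto simp: Boolean_iff word_product_Nil)
  then show ?case by (simp add: fib_int_def)
next
  case (3 n)
  then show ?case
    using card_Boolean_Suc_Suc[of n] fib_int_step2[of "2 * int n - 1"] by (simp add: algebra_simps)
qed

text \<open>Here j = i + 1, and d = n - j is the number of positions after j. As functions of d,
  both sides satisfy x(d + 2) = 3 x(d + 1) - x(d); the cases d = 0 and d = 1 are the counts for the
  last and the penultimate position.\<close>

lemma card_Boolean_records_add:
  "int (card (Boolean (Suc i + d) \<inter> records (Suc i)))
    = fib_int (2 * int (i + d)) - fib_int (2 * int i - 2) * fib_int (2 * int d - 1)"
proof (induction d rule: fib.induct)
  case 1
  then show ?case
    using card_Boolean_records_last[of i] card_Boolean[of i] fib_int_rec[of "2 * int i - 2"]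
    by (simp add: fib_int_def[of "-1"])
next
  case 2
  then show ?case
    using card_Boolean_records_penultimate[of i] card_Boolean[of i] card_Boolean[of "Suc i"]
      fib_int_rec[of "2 * int i - 2"] fib_int_rec[of "2 * int i"]
    by (simp add: fib_int_def[of "1"] algebra_simps)
next
  case (3 d)
  have "int (card (Boolean (Suc i + Suc (Suc d)) \<inter> records (Suc i)))
      = 3 * int (card (Boolean (Suc i + Suc d) \<inter> records (Suc i)))
        - int (card (Boolean (Suc i + d) \<inter> records (Suc i)))"
    using card_Boolean_records_step[of "Suc i" "Suc i + d"] by simp
  moreover have "fib_int (2 * int (i + Suc (Suc d))) = 3 * fib_int (2 * int (i + Suc d)) - fib_int (2 * int (i + d))"
    using fib_int_step2[of "2 * int (i + d)"] by (simp add: algebra_simps)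
  moreover have "fib_int (2 * int (Suc (Suc d)) - 1) = 3 * fib_int (2 * int (Suc d) - 1) - fib_int (2 * int d - 1)"
    using fib_int_step2[of "2 * int d - 1"] by (simp add: algebra_simps)
  ultimately show ?case
    using 3 by (simp only: left_diff_distrib right_diff_distrib mult.left_commute[of _ 3])
qed

lemma card_Boolean_records:
  assumes "j \<in> {1..n}"
  shows "int (card (Boolean n \<inter> records j))
    = fib_int (2 * int n - 2) - fib_int (2 * int j - 4) * fib_int (2 * (int n - int j) - 1)"
  using card_Boolean_records_add[of "j - 1" "n - j"] assms by (simp add: of_nat_diff algebra_simps)

section \<open>The probabilities as quotients of the counts\<close>

theorem theorem1p1:
  fixes n j :: nat
  assumes "n \<ge> 1" and "j \<in> {1..n}"
  shows "measure_pmf.prob (pmf_of_set (Sym n)) {w. rec_indicator j w = 1} = 1 / real j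
    \<and> measure_pmf.prob (pmf_of_set (Grassmannian n)) {w. rec_indicator j w = 1}
        = ((\<Sum>k=j..n. real (n choose k)) + 2 ^ (j - 1) - real n) / (2 ^ n - real n)
    \<and> measure_pmf.prob (pmf_of_set (Boolean n)) {w. rec_indicator j w = 1}
        = (of_int (fib_int (2 * int n - 2))
            - of_int (fib_int (2 * int j - 4)) * of_int (fib_int (2 * (int n - int j) - 1)))
          / of_int (fib_int (2 * int n - 1))
    \<and> (of_int (fib_int (2 * int n - 2))
            - of_int (fib_int (2 * int j - 4)) * of_int (fib_int (2 * (int n - int j) - 1)))
          / of_int (fib_int (2 * int n - 1))
        = (2 * golden_ratio powi (2 * int n - 2) + 2 * golden_ratio powi (2 - 2 * int n)
            + golden_ratio powi (2 * int n - 4 * int j + 3)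
            - golden_ratio powi (4 * int j - 2 * int n - 3))
          / (sqrt 5 * (golden_ratio powi (2 * int n - 1) + golden_ratio powi (1 - 2 * int n)))"
proof -
  have j: "1 \<le> j" "j \<le> n"
    using assms(2) by simp_all
  have "measure_pmf.prob (pmf_of_set (Sym n)) {w. rec_indicator j w = 1} = 1 / real j"
  proof -
    have "real j * real (card (Sym n \<inter> records j)) = fact n"
      using arg_cong[OF card_Sym_records[OF assms(2)], of real] by simp
    moreover have "Sym n \<noteq> {}"
      using id_in_Sym by blast
    ultimately show ?thesis
      using j unfolding prob_records[OF finite_Sym \<open>Sym n \<noteq> {}\<close>] card_Sym by (simp add: field_simps)
  qed
  moreover have "measure_pmf.prob (pmf_of_set (Grassmannian n)) {w. rec_indicator j w = 1}
      = ((\<Sum>k=j..n. real (n choose k)) + 2 ^ (j - 1) - real n) / (2 ^ n - real n)"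
  proof -
    \<comment> \<open>The additive counting identities are transferred to the reals, where n can be
      subtracted without truncation.\<close>
    have total: "real (card (Grassmannian n)) = 2 ^ n - real n"
      using arg_cong[OF card_Grassmannian[of n], of real] by simp
    have favourable: "real (card (Grassmannian n \<inter> records j))
        = (\<Sum>k=j..n. real (n choose k)) + 2 ^ (j - 1) - real n"
      using arg_cong[OF card_Grassmannian_records[OF assms(2)], of real] by simp
    have "Grassmannian n \<noteq> {}"
      using id_in_Grassmannian by blast
    from prob_records[OF finite_Grassmannian this, of j] show ?thesis
      unfolding total favourable .
  qed
  moreover have "measure_pmf.prob (pmf_of_set (Boolean n)) {w. rec_indicator j w = 1}
      = (of_int (fib_int (2 * int n - 2))
          - of_int (fib_int (2 * int j - 4)) * of_int (fib_int (2 * (int n - int j) - 1)))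
        / of_int (fib_int (2 * int n - 1))"
  proof -
    have total: "real (card (Boolean n)) = of_int (fib_int (2 * int n - 1))"
      using arg_cong[OF card_Boolean[of n], of real_of_int] by simp
    have favourable: "real (card (Boolean n \<inter> records j))
        = of_int (fib_int (2 * int n - 2))
          - of_int (fib_int (2 * int j - 4)) * of_int (fib_int (2 * (int n - int j) - 1))"
      using arg_cong[OF card_Boolean_records[OF assms(2)], of real_of_int] by simp
    have "Boolean n \<noteq> {}"
      using id_in_Boolean by blast
    from prob_records[OF finite_Boolean this, of j] show ?thesis
      unfolding total favourable .
  qed
  ultimately show ?thesis
    using fib_int_quotient_golden_ratio[of "int n" "int j"] by (intro conjI)
qed

end
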